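(* Let $H$ be a complex Hilbert space with $\dim H\geq 3$ and let $A$ be an invertible bounded linear operator on $H$ (with bounded inverse). For any $x,y\in H$ define $\underline{x} \cdot_A \underline{y}=|\langle Ax, y\rangle|$. Let $T:\underline{H} \to \underline{H}$ be a bijective transformation such that \[ T\underline{x}\cdot_A T\underline{y}=\underline{x}\cdot_A \underline{y} \qquad (x,y\in H). \] Then there is a bounded invertible operator $U$ on $H$, either linear or conjugate-linear, with $U^*AU=\epsilon A$ for some scalar $\epsilon\in\mathbb{C}$ of modulus $1$, such that \[ T\underline{x} =\underline{Ux} \qquad (x\in H). \]
   Context: For a vector $x\in H$, the ray associated to $x$ is the set $\underline{x}=\{\lambda x : \lambda\in\mathbb{C},\ |\lambda|=1\}$ (the zero vector is allowed, so $\underline{0}=\{0\}$). The set of all rays in $H$ is denoted $\underline{H}$. The quantity $\underline{x}\cdot_A\underline{y}$ depends only on the rays. The operator $A$ is not assumed to be self-adjoint. The inner product $\langle\cdot,\cdot\rangle$ is linear in the first variable and conjugate-linear in the second. For a bounded linear operator $U$, $U^*$ is the usual adjoint; for a bounded conjugate-linear operator $U$, $U^*$ is the bounded conjugate-linear operator determined by $\langle Ux,y\rangle=\overline{\langle x,U^*y\rangle}$ for all $x,y\in H$. *)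

theory Defs
  imports "HOL-Analysis.Analysis"
begin

class complex_inner_space = real_normed_vector +
  fixes scaleC :: "complex \<Rightarrow> 'a \<Rightarrow> 'a" (infixr "*\<^sub>C" 75)
    and cinner :: "'a \<Rightarrow> 'a \<Rightarrow> complex"
  assumes scaleC_add_right: "c *\<^sub>C (x + y) = c *\<^sub>C x + c *\<^sub>C y"
    and scaleC_add_left: "(c + d) *\<^sub>C x = c *\<^sub>C x + d *\<^sub>C x"
    and scaleC_scaleC: "c *\<^sub>C (d *\<^sub>C x) = (c * d) *\<^sub>C x"
    and scaleC_one: "1 *\<^sub>C x = x"
    and scaleR_scaleC: "r *\<^sub>R x = complex_of_real r *\<^sub>C x"
    and cinner_commute: "cinner x y = cnj (cinner y x)"
    and cinner_add_left: "cinner (x + y) z = cinner x z + cinner y z"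
    and cinner_scaleC_left: "cinner (c *\<^sub>C x) y = c * cinner x y"
    and cinner_self: "cinner x x = complex_of_real ((norm x)\<^sup>2)"
  \<comment> \<open>As \<open>norm\<close> is a norm, \<open>cinner_self\<close> makes \<open>cinner\<close> positive definite and
     \<open>norm\<close> the norm induced by it.\<close>

class complex_hilbert_space = complex_inner_space + complete_space

global_interpretation complex_vector:
  vector_space "scaleC :: complex \<Rightarrow> 'a \<Rightarrow> 'a::complex_inner_space"
  by unfold_locales
    (rule scaleC_add_right scaleC_add_left scaleC_scaleC scaleC_one)+

lemma cinner_scaleC_right:
  "cinner x (c *\<^sub>C y) = cnj c * cinner x y" for x y :: "'a::complex_inner_space"
  by (metis cinner_commute cinner_scaleC_left complex_cnj_mult)

lemma cinner_add_right:
  "cinner x (y + z) = cinner x y + cinner x z" for x y z :: "'a::complex_inner_space"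
  by (metis cinner_add_left cinner_commute complex_cnj_add)

lemma cinner_eqI:
  fixes y z :: "'a::complex_inner_space"
  assumes "\<And>x. cinner x y = cinner x z"
  shows "y = z"
proof -
  have "cinner (y - z) y = cinner (y - z) (y - z) + cinner (y - z) z"
    by (simp flip: cinner_add_right)
  with assms[of "y - z"] have "cinner (y - z) (y - z) = 0" by simp
  then show ?thesis by (simp add: cinner_self)
qed

text \<open>The constant \<open>complex_vector.dim\<close> is 0 on infinite-dimensional spaces, so the lower bound
  on the dimension is stated through the cardinality of a Hamel basis. For a finite bound \<open>n\<close>
  this agrees with the bound on the Hilbert dimension.\<close>

definition cdim_ge :: "'a::complex_inner_space itself \<Rightarrow> nat \<Rightarrow> bool" where
  "cdim_ge _ n \<longleftrightarrow> (\<exists>B :: 'a set. complex_vector.independent B \<and>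
     complex_vector.span B = UNIV \<and> (infinite B \<or> n \<le> card B))"

locale bounded_clinear = bounded_linear f
  for f :: "'a::complex_inner_space \<Rightarrow> 'b::complex_inner_space" +
  assumes scaleC: "f (c *\<^sub>C x) = c *\<^sub>C f x"

locale bounded_antilinear = bounded_linear f
  for f :: "'a::complex_inner_space \<Rightarrow> 'b::complex_inner_space" +
  assumes scaleC: "f (c *\<^sub>C x) = cnj c *\<^sub>C f x"

definition invertible_bounded_clinear :: "('a::complex_inner_space \<Rightarrow> 'a) \<Rightarrow> bool" where
  "invertible_bounded_clinear U \<longleftrightarrow> bounded_clinear U \<and>
     (\<exists>V. bounded_clinear V \<and> V \<circ> U = id \<and> U \<circ> V = id)"

definition invertible_bounded_antilinear :: "('a::complex_inner_space \<Rightarrow> 'a) \<Rightarrow> bool" where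
  "invertible_bounded_antilinear U \<longleftrightarrow> bounded_antilinear U \<and>
     (\<exists>V. bounded_antilinear V \<and> V \<circ> U = id \<and> U \<circ> V = id)"

text \<open>On a Hilbert space both descriptions below determine a unique operator for every bounded
  (anti)linear \<open>U\<close>: existence is the Riesz representation theorem, uniqueness is
  \<open>clinear_adjoint_eqI\<close> and \<open>antilinear_adjoint_eqI\<close>.\<close>

definition clinear_adjoint :: "('a::complex_hilbert_space \<Rightarrow> 'a) \<Rightarrow> 'a \<Rightarrow> 'a" where
  "clinear_adjoint U =
     (THE V. bounded_clinear V \<and> (\<forall>x y. cinner (U x) y = cinner x (V y)))"

definition antilinear_adjoint :: "('a::complex_hilbert_space \<Rightarrow> 'a) \<Rightarrow> 'a \<Rightarrow> 'a" where
  "antilinear_adjoint U =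
     (THE V. bounded_antilinear V \<and> (\<forall>x y. cinner (U x) y = cnj (cinner x (V y))))"

lemma clinear_adjoint_eqI:
  assumes "bounded_clinear V" "\<And>x y. cinner (U x) y = cinner x (V y)"
  shows "clinear_adjoint U = V"
  unfolding clinear_adjoint_def
proof (rule the_equality)
  fix W assume W: "bounded_clinear W \<and> (\<forall>x y. cinner (U x) y = cinner x (W y))"
  show "W = V"
  proof
    fix y show "W y = V y"
      by (rule cinner_eqI) (metis W assms(2))
  qed
qed (use assms in auto)

lemma antilinear_adjoint_eqI:
  assumes "bounded_antilinear V" "\<And>x y. cinner (U x) y = cnj (cinner x (V y))"
  shows "antilinear_adjoint U = V"
  unfolding antilinear_adjoint_def
proof (rule the_equality)
  fix W assume W: "bounded_antilinear W \<and> (\<forall>x y. cinner (U x) y = cnj (cinner x (W y)))"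
  show "W = V"
  proof
    fix y show "W y = V y"
      by (rule cinner_eqI) (metis W assms(2) complex_cnj_cancel_iff)
  qed
qed (use assms in auto)

definition ray :: "'a::complex_inner_space \<Rightarrow> 'a set" where
  "ray x = {c *\<^sub>C x |c. cmod c = 1}"

definition rays :: "'a::complex_inner_space set set" where
  "rays = range ray"

text \<open>The product of two rays with respect to \<open>A\<close> is the common value of \<open>cmod (cinner (A x) y)\<close>
  over all representatives; see \<open>ray_prod_ray\<close>.\<close>

definition ray_prod :: "('a::complex_inner_space \<Rightarrow> 'a) \<Rightarrow> 'a set \<Rightarrow> 'a set \<Rightarrow> real" where
  "ray_prod A X Y = (THE r. \<forall>x\<in>X. \<forall>y\<in>Y. r = cmod (cinner (A x) y))"

lemma self_mem_ray: "x \<in> ray x"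
  unfolding ray_def by (auto intro!: exI[of _ 1] simp: scaleC_one)

lemma ray_prod_ray:
  assumes "bounded_clinear A"
  shows "ray_prod A (ray x) (ray y) = cmod (cinner (A x) y)"
  unfolding ray_prod_def
proof (rule the_equality)
  show "\<forall>x'\<in>ray x. \<forall>y'\<in>ray y. cmod (cinner (A x) y) = cmod (cinner (A x') y')"
    by (auto simp: ray_def bounded_clinear.scaleC[OF assms] cinner_scaleC_left
        cinner_scaleC_right norm_mult)
qed (use self_mem_ray in blast)

end

theory Submission
  imports Defs
begin

text \<open>Why the theorem holds. Write \<open>B x y = cinner (A x) y\<close> and choose a representative \<open>f x\<close> of
  \<open>T (ray x)\<close> for every \<open>x\<close>. Then \<open>f\<close> preserves the modulus of \<open>B\<close>, hence \<open>B\<close>-orthogonality, and it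
  is onto up to phases. Since \<open>A\<close> is injective, \<open>B\<close>-orthogonality detects membership in finite spans
  (\<open>exists_B_dual\<close>), so \<open>f\<close> maps finite spans into spans (\<open>f_span\<close>): it acts on the projective space
  as a collineation. The moduli give more, namely that \<open>f (x + y)\<close> is a combination of \<open>f x\<close> and
  \<open>f y\<close> with coefficients of modulus 1 when \<open>x\<close> and \<open>y\<close> are independent
  (\<open>f_add_of_independent\<close>).

  What remains is to choose the phases coherently, as in the fundamental theorem of projective
  geometry. Fix a unit vector \<open>e\<close>. For \<open>m\<close> orthogonal to \<open>e\<close>, the phase of \<open>U m\<close> is chosen so
  that \<open>f e + U m\<close> lies in the ray of \<open>f (e + m)\<close>. Considering \<open>e + y + z\<close> shows that \<open>U\<close> is additive
  on independent pairs (\<open>U_coefficient_one\<close>). As the complement of \<open>e\<close> has dimension at least 2, the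
  factor \<open>\<sigma> c\<close> by which \<open>U\<close> scales when its argument is multiplied by \<open>c\<close> does not depend on the
  vector, and \<open>\<sigma>\<close> is a field homomorphism that preserves moduli. Therefore \<open>\<sigma>\<close> is the identity or
  conjugation (\<open>modulus_preserving_automorphism\<close>), and extending \<open>U\<close> by \<open>f e\<close> gives a bijective
  linear or conjugate-linear operator that induces \<open>T\<close> (\<open>semilinear_representatives\<close>).

  The two forms \<open>B x y\<close> and \<open>\<sigma> (B (U x) (U y))\<close> are sesquilinear with equal modulus and so differ by
  a constant phase \<open>\<epsilon>\<close> (\<open>forms_equal_modulus\<close>). This identity says that \<open>A U A\<^sup>-\<^sup>1\<close> and \<open>U\<^sup>-\<^sup>1\<close> are
  adjoint to each other up to a phase. Everywhere defined operators with an adjoint are bounded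
  (\<open>bounded_if_adjoint\<close>), so \<open>U\<close> and its inverse are bounded, and the same identity exhibits
  \<open>\<epsilon> A U\<^sup>-\<^sup>1 A\<^sup>-\<^sup>1\<close> as the adjoint of \<open>U\<close>.\<close>


section \<open>Inner products and dual vectors\<close>

lemma cinner_zero_left [simp]: "cinner 0 y = 0" for y :: "'a::complex_inner_space"
  using cinner_scaleC_left[of 0 0 y] by simp

lemma cinner_zero_right [simp]: "cinner x 0 = 0" for x :: "'a::complex_inner_space"
  using cinner_scaleC_right[of x 0 0] by simp

lemma cinner_diff_left: "cinner (x - y) z = cinner x z - cinner y z"
  for x y z :: "'a::complex_inner_space"
  using cinner_add_left[of "x - y" y z] by simp

lemma cinner_diff_right: "cinner x (y - z) = cinner x y - cinner x z"
  for x y z :: "'a::complex_inner_space"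
  using cinner_add_right[of x "y - z" z] by simp

lemmas cinner_linear = cinner_add_left cinner_add_right cinner_diff_left cinner_diff_right
  cinner_scaleC_left cinner_scaleC_right

lemma cinner_eq_zero_iff [simp]: "cinner x x = 0 \<longleftrightarrow> x = 0" for x :: "'a::complex_inner_space"
  by (simp add: cinner_self)

lemma norm_scaleC: "norm (c *\<^sub>C x) = cmod c * norm x" for x :: "'a::complex_inner_space"
proof -
  have "complex_of_real ((norm (c *\<^sub>C x))\<^sup>2) = c * cnj c * cinner x x"
    unfolding cinner_self[symmetric] by (simp add: cinner_linear)
  also have "\<dots> = complex_of_real ((cmod c * norm x)\<^sup>2)"
    by (simp add: complex_norm_square[symmetric] cinner_self power_mult_distrib)
  finally have "(norm (c *\<^sub>C x))\<^sup>2 = (cmod c * norm x)\<^sup>2"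
    by (simp only: of_real_eq_iff)
  then show ?thesis by (simp add: power2_eq_iff_nonneg)
qed

lemma cinner_Cauchy_Schwarz: "cmod (cinner x y) \<le> norm x * norm y"
  for x y :: "'a::complex_inner_space"
proof (cases "y = 0")
  case False
  define c where "c = cinner x y / cinner y y"
  have y: "cinner y y \<noteq> 0" using False by simp
  \<comment> \<open>Pythagoras for the component of \<open>x\<close> along \<open>y\<close>\<close>
  have orth: "cinner (x - c *\<^sub>C y) y = 0" using y by (simp add: cinner_linear c_def)
  have "cinner y (x - c *\<^sub>C y) = 0" using orth cinner_commute[of y "x - c *\<^sub>C y"] by simp
  then have "cinner x x = cinner (x - c *\<^sub>C y) (x - c *\<^sub>C y) + c * cnj c * cinner y y"
    using orth by (simp add: cinner_linear algebra_simps)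
  then have "complex_of_real ((norm x)\<^sup>2)
      = complex_of_real ((norm (x - c *\<^sub>C y))\<^sup>2 + (cmod c)\<^sup>2 * (norm y)\<^sup>2)"
    by (simp add: cinner_self complex_norm_square[symmetric] power_mult_distrib)
  then have "(norm x)\<^sup>2 = (norm (x - c *\<^sub>C y))\<^sup>2 + (cmod c)\<^sup>2 * (norm y)\<^sup>2"
    by (simp only: of_real_eq_iff)
  then have "(cmod c * norm y)\<^sup>2 \<le> (norm x)\<^sup>2" by (simp add: power_mult_distrib)
  then have le: "cmod c * norm y \<le> norm x" using norm_ge_zero power2_le_imp_le by blast
  have "cmod (cinner x y) = cmod c * norm y * norm y"
    using False by (simp add: c_def cinner_self norm_divide norm_power norm_mult power2_eq_square)
  then show ?thesis using le by (simp add: mult_right_mono)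
qed simp

text \<open>The inductive step is one Gram-Schmidt-like correction: if \<open>v\<close> is dual to \<open>s\<close> relative to
  \<open>S\<close>, subtracting a multiple of \<open>v\<close> makes a vector that annihilates \<open>S\<close> annihilate \<open>s\<close> as well.\<close>

lemma exists_dual_vector:
  fixes x :: "'a::complex_inner_space"
  assumes "finite S" "x \<notin> complex_vector.span S"
  shows "\<exists>w. (\<forall>s\<in>S. cinner s w = 0) \<and> cinner x w = 1"
  using assms
proof (induction S arbitrary: x)
  case empty
  then have "x \<noteq> 0" by auto
  then show ?case
    by (intro exI[of _ "(1 / cnj (cinner x x)) *\<^sub>C x"]) (simp add: cinner_linear)
next
  case (insert s S)
  show ?case
  proof (cases "s \<in> complex_vector.span S")
    case True
    then have "x \<notin> complex_vector.span S"
      using insert.prems complex_vector.span_mono[of S "insert s S"] by blast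
    then obtain w where w: "\<forall>t\<in>S. cinner t w = 0" "cinner x w = 1"
      using insert.IH by blast
    have "cinner s w = 0"
      using True by (induction rule: complex_vector.span_induct_alt) (simp_all add: cinner_linear w)
    then show ?thesis using w by auto
  next
    case False
    then obtain v where v: "\<forall>t\<in>S. cinner t v = 0" "cinner s v = 1"
      using insert.IH by blast
    have "x - cinner x v *\<^sub>C s \<notin> complex_vector.span S"
      using insert.prems complex_vector.span_breakdown_eq by blast
    then obtain u where u: "\<forall>t\<in>S. cinner t u = 0" "cinner (x - cinner x v *\<^sub>C s) u = 1"
      using insert.IH by blast
    show ?thesis
      using u v by (intro exI[of _ "u - cnj (cinner s u) *\<^sub>C v"])
        (auto simp: cinner_linear algebra_simps)
  qed
qed

section \<open>Forms with equal modulus\<close>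

text \<open>Equal moduli give equal kernels, and a functional is determined by its kernel up to a
  factor. The function \<open>\<tau>\<close> covers linear and conjugate-linear functionals at once.\<close>

lemma functionals_equal_modulus:
  fixes g h :: "'a::complex_inner_space \<Rightarrow> complex"
  assumes g: "\<And>x c y. g (x + c *\<^sub>C y) = g x + \<tau> c * g y"
    and h: "\<And>x c y. h (x + c *\<^sub>C y) = h x + \<tau> c * h y"
    and "surj \<tau>" and "\<And>x. cmod (g x) = cmod (h x)"
  shows "\<exists>\<epsilon>. \<forall>x. g x = \<epsilon> * h x"
proof (cases "\<forall>x. h x = 0")
  case True
  then show ?thesis using assms(4) by (metis mult_zero_right norm_eq_zero)
next
  case False
  then obtain y where y: "h y \<noteq> 0" by auto
  have "g x = g y / h y * h x" for x
  proof -
    obtain c where c: "\<tau> c = - h x / h y" using \<open>surj \<tau>\<close> by (metis surjD)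
    have "h (x + c *\<^sub>C y) = 0" using y by (simp add: h c)
    then have "g (x + c *\<^sub>C y) = 0" using assms(4)[of "x + c *\<^sub>C y"] by simp
    then show ?thesis using y by (simp add: g c)
  qed
  then show ?thesis by blast
qed

lemma surj_cnj: "surj cnj"
  by (metis complex_cnj_cnj surjI)

text \<open>By the previous lemma \<open>C\<close> is \<open>B\<close> times a factor depending on \<open>x\<close> alone, and also \<open>B\<close> times a
  factor depending on \<open>y\<close> alone. The two factors agree wherever \<open>B\<close> does not vanish, and any two
  rows of \<open>B\<close> that are not identically zero share a column where both are nonzero, so the factor
  is constant.\<close>

lemma forms_equal_modulus:
  fixes B C :: "'a::complex_inner_space \<Rightarrow> 'a \<Rightarrow> complex"
  assumes Bl: "\<And>x c y z. B (x + c *\<^sub>C y) z = B x z + c * B y z"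
    and Br: "\<And>x c y z. B z (x + c *\<^sub>C y) = B z x + cnj c * B z y"
    and Cl: "\<And>x c y z. C (x + c *\<^sub>C y) z = C x z + c * C y z"
    and Cr: "\<And>x c y z. C z (x + c *\<^sub>C y) = C z x + cnj c * C z y"
    and mod: "\<And>x y. cmod (C x y) = cmod (B x y)"
  shows "\<exists>\<epsilon>. cmod \<epsilon> = 1 \<and> (\<forall>x y. C x y = \<epsilon> * B x y)"
proof -
  have "\<exists>\<epsilon>. \<forall>y. C x y = \<epsilon> * B x y" for x
    using functionals_equal_modulus[of "C x" cnj "B x"] Br Cr mod surj_cnj by blast
  then obtain \<epsilon> where \<epsilon>: "\<And>x y. C x y = \<epsilon> x * B x y" by metis
  have "\<exists>\<delta>. \<forall>x. C x y = \<delta> * B x y" for y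
    using functionals_equal_modulus[of "\<lambda>x. C x y" id "\<lambda>x. B x y"] Bl Cl mod by simp
  then obtain \<delta> where \<delta>: "\<And>x y. C x y = \<delta> y * B x y" by metis
  have same: "\<epsilon> x = \<epsilon> x'" if nz: "B x y \<noteq> 0" "B x' y' \<noteq> 0" for x x' y y'
  proof -
    \<comment> \<open>two proper subspaces, the kernels of \<open>B x\<close> and \<open>B x'\<close>, do not cover the space\<close>
    have "B x (y + 1 *\<^sub>C y') = B x y + B x y'" "B x' (y + 1 *\<^sub>C y') = B x' y + B x' y'"
      by (simp_all only: Br) simp_all
    then obtain z where z: "B x z \<noteq> 0" "B x' z \<noteq> 0"
      using nz by (metis add_0 add.right_neutral)
    have "\<epsilon> x = \<delta> z" "\<epsilon> x' = \<delta> z"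
      using \<epsilon>[of x z] \<delta>[of x z] \<epsilon>[of x' z] \<delta>[of x' z] z by auto
    then show ?thesis by simp
  qed
  show ?thesis
  proof (cases "\<exists>x y. B x y \<noteq> 0")
    case True
    then obtain x y where xy: "B x y \<noteq> 0" by blast
    have "C x' y' = \<epsilon> x * B x' y'" for x' y'
      using same[OF xy, of x' y'] \<epsilon>[of x' y'] by (cases "B x' y' = 0") auto
    moreover have "cmod (\<epsilon> x) = 1"
      using mod[of x y] \<epsilon>[of x y] xy by (simp add: norm_mult)
    ultimately show ?thesis by blast
  next
    case False
    then have "C x y = 1 * B x y" for x y using mod[of x y] by simp
    then show ?thesis by (intro exI[of _ 1]) simp
  qed
qed

section \<open>Automatic continuity\<close>

lemma continuous_on_cinner_right: "continuous_on UNIV (cinner x)"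
  for x :: "'a::complex_inner_space"
proof -
  have "bounded_linear (cinner x)"
  proof (rule bounded_linear_intro)
    show "cinner x (r *\<^sub>R y) = r *\<^sub>R cinner x y" for r y
      by (simp add: scaleR_scaleC cinner_linear scaleR_conv_of_real)
    show "norm (cinner x y) \<le> norm y * norm x" for y
      using cinner_Cauchy_Schwarz[of x y] by (simp add: mult.commute)
  qed (simp add: cinner_linear)
  then show ?thesis by (simp add: linear_continuous_on)
qed

text \<open>The norm of \<open>V z\<close> is the supremum of \<open>cmod (cinner x (V z)) / norm x\<close> over nonzero \<open>x\<close>, and
  the adjoint relation turns each of these quantities into a continuous function of \<open>z\<close>.\<close>

lemma closed_norm_sublevel_if_adjoint:
  fixes G V :: "'a::complex_inner_space \<Rightarrow> 'a"
  assumes adj: "\<And>x z. cmod (cinner (G x) z) = cmod (cinner x (V z))"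
    and "0 \<le> r"
  shows "closed {z. norm (V z) \<le> r}"
proof -
  have "norm (V z) \<le> r \<longleftrightarrow> (\<forall>x. cmod (cinner (G x) z) \<le> norm x * r)" for z
  proof
    assume "norm (V z) \<le> r"
    then show "\<forall>x. cmod (cinner (G x) z) \<le> norm x * r"
      using cinner_Cauchy_Schwarz adj by (metis mult_left_mono norm_ge_zero order_trans)
  next
    assume "\<forall>x. cmod (cinner (G x) z) \<le> norm x * r"
    then have "norm (V z) * norm (V z) \<le> norm (V z) * r"
      using adj[of "V z" z] by (metis cinner_self norm_ge_zero norm_of_real abs_of_nonneg
          power2_eq_square zero_le_power2)
    then show "norm (V z) \<le> r"
      using \<open>0 \<le> r\<close> by (metis mult_le_cancel_left_pos norm_ge_zero order_le_less)
  qed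
  then have "{z. norm (V z) \<le> r} = (\<Inter>x. {z. cmod (cinner (G x) z) \<le> norm x * r})" by auto
  moreover have "closed {z. cmod (cinner (G x) z) \<le> norm x * r}" for x
    by (intro closed_Collect_le continuous_intros continuous_on_cinner_right)
  ultimately show ?thesis by auto
qed

text \<open>A form of the Hellinger-Toeplitz theorem. The closed sets on which \<open>norm (V z)\<close> is at most
  \<open>n\<close> cover the space, so by Baire one of them contains a ball, and linearity spreads the bound on
  that ball to the whole space.\<close>

lemma bounded_if_adjoint:
  fixes G V :: "'a::complex_hilbert_space \<Rightarrow> 'a"
  assumes adj: "\<And>x z. cmod (cinner (G x) z) = cmod (cinner x (V z))"
    and "linear V"
  shows "bounded_linear V"
proof -
  interpret V: linear V by fact
  define E where "E n = {z. norm (V z) \<le> real n}" for n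
  have "\<exists>n. interior (E n) \<noteq> {}"
  proof (rule ccontr)
    assume "\<not> ?thesis"
    then have "interior (\<Union>(range E)) = {}"
      using Baire_category_alt[of "euclidean :: 'a topology" "range E"]
        closed_norm_sublevel_if_adjoint[OF adj] completely_metrizable_space_euclidean
      by (force simp: E_def)
    moreover have "\<Union>(range E) = UNIV"
      by (auto simp: E_def intro: real_arch_simple)
    ultimately show False by simp
  qed
  then obtain n a r where r: "0 < r" "cball a r \<subseteq> E n"
    using mem_interior_cball by blast
  have "norm (V z) \<le> norm z * (2 * real n / r)" for z
  proof (cases "z = 0")
    case False
    \<comment> \<open>scaling that moves \<open>a\<close> to the boundary of the ball in the direction of \<open>z\<close>\<close>
    define t where "t = r / norm z"
    have t: "0 < t" using False r by (simp add: t_def)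
    have "a \<in> cball a r" "a + t *\<^sub>R z \<in> cball a r"
      using r False by (auto simp: dist_norm t_def)
    then have "norm (V a) \<le> n" "norm (V (a + t *\<^sub>R z)) \<le> n"
      using r(2) unfolding E_def by blast+
    moreover have "t *\<^sub>R V z = V (a + t *\<^sub>R z) - V a" by (simp add: V.add V.scale)
    ultimately have "norm (t *\<^sub>R V z) \<le> 2 * real n"
      by (metis add_mono mult_2 norm_triangle_ineq4 order_trans)
    then show ?thesis using t r False by (simp add: t_def field_simps)
  qed (simp add: V.zero)
  then show ?thesis
    using V.add V.scale by (intro bounded_linear_intro[where K = "2 * real n / r"])
qed

section \<open>Automorphisms of the complex field that preserve the modulus\<close>

text \<open>Preserving the distances to \<open>0\<close> and \<open>-1\<close> fixes real parts, and the value at the imaginary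
  unit then decides the sign of all imaginary parts together.\<close>

lemma modulus_preserving_automorphism:
  fixes \<sigma> :: "complex \<Rightarrow> complex"
  assumes add: "\<And>x y. \<sigma> (x + y) = \<sigma> x + \<sigma> y"
    and mult: "\<And>x y. \<sigma> (x * y) = \<sigma> x * \<sigma> y"
    and norm: "\<And>x. cmod (\<sigma> x) = cmod x"
  shows "\<sigma> = id \<or> \<sigma> = cnj"
proof -
  have "\<sigma> 1 * \<sigma> 1 = \<sigma> 1" "\<sigma> 1 \<noteq> 0" using mult[of 1 1] norm[of 1] by auto
  then have one: "\<sigma> 1 = 1" by simp
  have Re: "Re (\<sigma> z) = Re z" for z
  proof -
    have "(cmod (\<sigma> z + 1))\<^sup>2 = (cmod (z + 1))\<^sup>2" "(cmod (\<sigma> z))\<^sup>2 = (cmod z)\<^sup>2"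
      using norm[of "z + 1"] norm[of z] by (simp_all add: add one)
    then show ?thesis unfolding cmod_power2 by (simp add: power2_eq_square algebra_simps)
  qed
  have "Re (\<sigma> \<i>) = 0" "(cmod (\<sigma> \<i>))\<^sup>2 = 1" using Re[of \<i>] norm[of \<i>] by auto
  then have "(Im (\<sigma> \<i>))\<^sup>2 = 1" by (simp add: cmod_power2)
  then have i: "\<sigma> \<i> = \<i> \<or> \<sigma> \<i> = - \<i>"
    using \<open>Re (\<sigma> \<i>) = 0\<close> by (auto simp: power2_eq_1_iff complex_eq_iff)
  have "Re (\<sigma> \<i> * \<sigma> z) = - Im z" for z
    using Re[of "\<i> * z"] by (simp add: mult)
  then have "(\<forall>z. Im (\<sigma> z) = Im z) \<or> (\<forall>z. Im (\<sigma> z) = - Im z)"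
    using i by auto
  then show ?thesis using Re by (auto simp: fun_eq_iff complex_eq_iff)
qed

section \<open>Ray symmetries and spans\<close>

text \<open>Here \<open>f\<close> picks an arbitrary representative of the image of each ray, so that nothing is
  known about its phases. Surjectivity on rays becomes surjectivity up to a phase; together with
  the preservation of moduli it carries the geometric part of the argument.\<close>

locale ray_symmetry =
  A: Vector_Spaces.linear "scaleC :: complex \<Rightarrow> 'a::complex_inner_space \<Rightarrow> 'a" scaleC A
  for A :: "'a::complex_inner_space \<Rightarrow> 'a" +
  fixes f :: "'a \<Rightarrow> 'a"
  assumes A_inj: "inj A"
    and f_preserves: "\<And>x y. cmod (cinner (A (f x)) (f y)) = cmod (cinner (A x) y)"
    and f_onto: "\<And>z. \<exists>x c. cmod c = 1 \<and> z = c *\<^sub>C f x"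
begin

definition B :: "'a \<Rightarrow> 'a \<Rightarrow> complex" where
  "B x y = cinner (A x) y"

lemma f_modulus: "cmod (B (f x) (f y)) = cmod (B x y)"
  by (simp add: B_def f_preserves)

lemma f_orthogonal_iff: "B (f x) (f y) = 0 \<longleftrightarrow> B x y = 0"
  using f_modulus[of x y] by (metis norm_eq_zero)

lemma B_simps [simp]:
  "B (x + y) z = B x z + B y z" "B (x - y) z = B x z - B y z"
  "B (c *\<^sub>C x) z = c * B x z" "B 0 z = 0" "B z (c *\<^sub>C x) = cnj c * B z x"
  by (simp_all add: B_def A.add A.diff A.scale A.zero cinner_linear)

lemma exists_B_dual:
  assumes "finite S" "x \<notin> complex_vector.span S"
  shows "\<exists>w. (\<forall>s\<in>S. B s w = 0) \<and> B x w = 1"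
proof -
  have "A x \<notin> complex_vector.span (A ` S)"
    using assms(2) A_inj by (simp add: A.span_image inj_image_mem_iff)
  then show ?thesis
    using exists_dual_vector[of "A ` S" "A x"] assms(1) by (auto simp: B_def)
qed

lemma B_vanishes_on_span:
  assumes "\<forall>s\<in>S. B s w = 0" "x \<in> complex_vector.span S"
  shows "B x w = 0"
  using assms(2) by (induction rule: complex_vector.span_induct_alt) (simp_all add: assms(1))

text \<open>Membership in a span can be tested by \<open>B\<close>-orthogonality: a vector outside \<open>span (f ` S)\<close>
  would be detected by some \<open>w\<close> that annihilates \<open>f ` S\<close>. As \<open>w\<close> is, up to a phase, a value \<open>f y\<close>,
  this orthogonality pattern can be pulled back along \<open>f\<close>.\<close>

lemma f_span:
  assumes "finite S" "x \<in> complex_vector.span S"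
  shows "f x \<in> complex_vector.span (f ` S)"
proof (rule ccontr)
  assume "\<not> ?thesis"
  then obtain w where w: "\<forall>s\<in>S. B (f s) w = 0" "B (f x) w = 1"
    using exists_B_dual[of "f ` S" "f x"] assms(1) by auto
  obtain y c where y: "cmod c = 1" "w = c *\<^sub>C f y" using f_onto by blast
  have "c \<noteq> 0" using y(1) by auto
  then have "\<forall>s\<in>S. B s y = 0" using w y by (auto simp: f_orthogonal_iff)
  then have "B x y = 0" using B_vanishes_on_span assms(2) by blast
  then show False using w y f_orthogonal_iff[of x y] by simp
qed

lemma f_zero [simp]: "f 0 = 0"
  using f_span[of "{}" 0] by simp

lemma f_scale: "\<exists>k. cmod k = cmod c \<and> f (c *\<^sub>C x) = k *\<^sub>C f x"
proof (cases "x = 0")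
  case False
  have "c *\<^sub>C x \<in> complex_vector.span {x}" by (auto simp: complex_vector.span_singleton)
  then have "f (c *\<^sub>C x) \<in> complex_vector.span {f x}" using f_span[of "{x}" "c *\<^sub>C x"] by simp
  then obtain k where k: "f (c *\<^sub>C x) = k *\<^sub>C f x"
    by (auto simp: complex_vector.span_singleton)
  obtain w where w: "B x w = 1" using exists_B_dual[of "{}" x] False by auto
  have "cmod k = cmod c"
    using f_modulus[of "c *\<^sub>C x" w] f_modulus[of x w] by (simp add: k w norm_mult)
  then show ?thesis using k by blast
qed (auto intro!: exI[of _ c])

lemma not_in_span_singleton_commute:
  assumes "x \<noteq> 0" "y \<notin> complex_vector.span {x}"
  shows "x \<notin> complex_vector.span {y :: 'a}"
  using complex_vector.in_span_insert[of x y "{}"] assms by auto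

lemma scale_notin_span_scale:
  assumes "c \<noteq> 0" "y \<notin> complex_vector.span {z}"
  shows "c *\<^sub>C y \<notin> complex_vector.span {c *\<^sub>C z :: 'a}"
proof
  assume "c *\<^sub>C y \<in> complex_vector.span {c *\<^sub>C z}"
  then obtain k where "c *\<^sub>C y = k *\<^sub>C c *\<^sub>C z"
    by (auto simp: complex_vector.span_singleton)
  then have "c *\<^sub>C y = c *\<^sub>C k *\<^sub>C z" by (simp add: mult.commute)
  then have "y = k *\<^sub>C z" using assms(1) complex_vector.scale_left_imp_eq by blast
  then show False using assms(2) by (auto simp: complex_vector.span_singleton)
qed

text \<open>The span of \<open>f x\<close> and \<open>f y\<close> contains \<open>f (x + y)\<close>, and testing against vectors dual to \<open>x\<close>
  and \<open>y\<close> fixes the moduli of the two coefficients.\<close>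

lemma f_add_of_independent:
  assumes "x \<notin> complex_vector.span {y}" "y \<notin> complex_vector.span {x}"
  shows "\<exists>a b. cmod a = 1 \<and> cmod b = 1 \<and> f (x + y) = a *\<^sub>C f x + b *\<^sub>C f y"
proof -
  have "x + y \<in> complex_vector.span {x, y}"
    by (simp add: complex_vector.span_add complex_vector.span_base)
  then have "f (x + y) \<in> complex_vector.span {f x, f y}" using f_span[of "{x, y}"] by simp
  then obtain a b where "f (x + y) - a *\<^sub>C f x = b *\<^sub>C f y"
    by (auto simp: complex_vector.span_insert[of "f x"] complex_vector.span_singleton)
  then have ab: "f (x + y) = a *\<^sub>C f x + b *\<^sub>C f y" by (simp add: algebra_simps)
  obtain v where v: "B y v = 0" "B x v = 1" using exists_B_dual[of "{y}" x] assms by auto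
  obtain w where w: "B x w = 0" "B y w = 1" using exists_B_dual[of "{x}" y] assms by auto
  have "cmod a = 1"
    using f_modulus[of "x + y" v] f_modulus[of x v] f_orthogonal_iff[of y v]
    by (simp add: ab v norm_mult)
  moreover have "cmod b = 1"
    using f_modulus[of "x + y" w] f_modulus[of y w] f_orthogonal_iff[of x w]
    by (simp add: ab w norm_mult)
  ultimately show ?thesis using ab by blast
qed

end

section \<open>Choosing the phases\<close>

text \<open>The unit vector \<open>e\<close> serves as a phase reference on its orthogonal complement.\<close>

locale framed_ray_symmetry = ray_symmetry +
  fixes e :: 'a
  assumes e_unit: "cinner e e = 1"
begin

text \<open>Calibrates the phase of \<open>f m\<close> against that of \<open>f e\<close>. It is meaningful for \<open>m\<close> orthogonal to
  \<open>e\<close>, where such a choice exists by \<open>U_spec\<close>.\<close>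

definition U :: "'a \<Rightarrow> 'a" where
  "U m = (SOME v. (\<exists>c. cmod c = 1 \<and> v = c *\<^sub>C f m) \<and>
     (\<exists>d. cmod d = 1 \<and> f (e + m) = d *\<^sub>C (f e + v)))"

lemma U_spec:
  assumes m: "cinner m e = 0"
  shows "(\<exists>c. cmod c = 1 \<and> U m = c *\<^sub>C f m) \<and>
     (\<exists>d. cmod d = 1 \<and> f (e + m) = d *\<^sub>C (f e + U m))"
  unfolding U_def
proof (rule someI_ex, cases "m = 0")
  case True
  then show "\<exists>v. (\<exists>c. cmod c = 1 \<and> v = c *\<^sub>C f m) \<and>
     (\<exists>d. cmod d = 1 \<and> f (e + m) = d *\<^sub>C (f e + v))"
    by (intro exI[of _ 0] conjI exI[of _ 1]) (simp_all add: scaleC_one)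
next
  case False
  have "e \<notin> complex_vector.span {m}"
    using e_unit m by (auto simp: complex_vector.span_singleton cinner_linear)
  moreover have "m \<notin> complex_vector.span {e}"
    using not_in_span_singleton_commute False calculation by blast
  ultimately obtain a b
    where ab: "cmod a = 1" "cmod b = 1" "f (e + m) = a *\<^sub>C f e + b *\<^sub>C f m"
    using f_add_of_independent by blast
  have "a \<noteq> 0" using ab by auto
  then have "f (e + m) = a *\<^sub>C (f e + (b / a) *\<^sub>C f m)"
    by (simp add: ab scaleC_add_right)
  moreover have "cmod (b / a) = 1" using ab by (simp add: norm_divide)
  ultimately show "\<exists>v. (\<exists>c. cmod c = 1 \<and> v = c *\<^sub>C f m) \<and>
     (\<exists>d. cmod d = 1 \<and> f (e + m) = d *\<^sub>C (f e + v))"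
    using ab(1) by blast
qed

lemma U_in_ray:
  assumes "cinner m e = 0"
  obtains c where "cmod c = 1" "c \<noteq> 0" "U m = c *\<^sub>C f m"
  using U_spec[OF assms] by force

lemma f_e_add:
  assumes "cinner m e = 0"
  obtains d where "cmod d = 1" "d \<noteq> 0" "f (e + m) = d *\<^sub>C (f e + U m)"
  using U_spec[OF assms] by force

lemma U_zero [simp]: "U 0 = 0"
  using U_in_ray[of 0] by force

lemma U_orthogonal_iff:
  assumes "cinner m e = 0"
  shows "B (U m) (f w) = 0 \<longleftrightarrow> B m w = 0"
  using U_in_ray[OF assms] by (metis B_simps(3) f_orthogonal_iff mult_eq_0_iff)

lemma U_nonzero:
  assumes "cinner m e = 0" "m \<noteq> 0"
  shows "U m \<noteq> 0"
proof -
  obtain w where "B m w = 1" using exists_B_dual[of "{}" m] assms by auto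
  then have "B (U m) (f w) \<noteq> 0" using U_orthogonal_iff assms by simp
  then show ?thesis by auto
qed

text \<open>The vector \<open>e + y + z\<close> lies in the span of \<open>e + y\<close> and \<open>z\<close>, whose images are \<open>f e + U y\<close> and
  \<open>U z\<close> up to factors. A vector \<open>w\<close> that annihilates both \<open>e + y\<close> and \<open>z\<close> but not \<open>e\<close> therefore
  annihilates \<open>e + y + z\<close>, and on the images this forces the coefficient of \<open>U y\<close> in \<open>U (y + z)\<close>
  to be the one it has in \<open>f e + U y\<close>.\<close>

lemma U_coefficient_one:
  assumes y: "cinner y e = 0" and z: "cinner z e = 0"
    and indep: "y \<notin> complex_vector.span {z}"
    and sum: "U (y + z) = \<gamma> *\<^sub>C U y + \<delta> *\<^sub>C U z"
  shows "\<gamma> = 1"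
proof -
  have "e \<notin> complex_vector.span {e + y, z}"
  proof
    assume "e \<in> complex_vector.span {e + y, z}"
    then obtain k j where kj: "e - k *\<^sub>C (e + y) = j *\<^sub>C z"
      by (auto simp: complex_vector.span_insert[of "e + y"] complex_vector.span_singleton)
    then have "cinner (e - k *\<^sub>C (e + y)) e = cinner (j *\<^sub>C z) e" by simp
    then have "k = 1" using e_unit y z by (simp add: cinner_linear)
    then have "- y = j *\<^sub>C z" using kj by (simp add: scaleC_one)
    then have "y = (- j) *\<^sub>C z" by (metis complex_vector.scale_minus_left minus_minus)
    then show False using indep unfolding complex_vector.span_singleton by blast
  qed
  then obtain w where w: "B (e + y) w = 0" "B z w = 0" "B e w = 1"
    using exists_B_dual[of "{e + y, z}" e] by auto
  obtain d where d: "d \<noteq> 0" "f (e + y) = d *\<^sub>C (f e + U y)" using f_e_add[OF y] .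
  obtain d' where d': "d' \<noteq> 0" "f (e + (y + z)) = d' *\<^sub>C (f e + U (y + z))"
    using f_e_add[of "y + z"] y z by (auto simp: cinner_linear)
  have "B (f (e + y)) (f w) = 0" "B (f (e + (y + z))) (f w) = 0" "B (f e) (f w) \<noteq> 0"
    using w by (simp_all add: f_orthogonal_iff del: B_simps(1)) (simp add: w flip: add.assoc)
  moreover have "B (U z) (f w) = 0" using w U_orthogonal_iff z by simp
  ultimately have "B (f e) (f w) + B (U y) (f w) = 0" "B (f e) (f w) + \<gamma> * B (U y) (f w) = 0"
    and "B (f e) (f w) \<noteq> 0"
    using d d' by (auto simp: sum)
  then show ?thesis
    by (metis add.right_neutral add_left_cancel mult_cancel_right1 mult.commute mult_zero_right)
qed

lemma U_add_of_independent:
  assumes y: "cinner y e = 0" and z: "cinner z e = 0"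
    and "y \<notin> complex_vector.span {z}" "z \<notin> complex_vector.span {y}"
  shows "U (y + z) = U y + U z"
proof -
  obtain a b where ab: "f (y + z) = a *\<^sub>C f y + b *\<^sub>C f z"
    using f_add_of_independent assms by blast
  obtain c where c: "U (y + z) = c *\<^sub>C f (y + z)"
    using U_in_ray[of "y + z"] y z by (auto simp: cinner_linear)
  obtain c1 where c1: "c1 \<noteq> 0" "U y = c1 *\<^sub>C f y" using U_in_ray[OF y] .
  obtain c2 where c2: "c2 \<noteq> 0" "U z = c2 *\<^sub>C f z" using U_in_ray[OF z] .
  have sum: "U (y + z) = (c * a / c1) *\<^sub>C U y + (c * b / c2) *\<^sub>C U z"
    using c1 c2 by (simp add: c ab scaleC_add_right)
  have "c * a / c1 = 1" using U_coefficient_one[OF y z assms(3) sum] .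
  moreover have "c * b / c2 = 1"
    using U_coefficient_one[OF z y assms(4), of "c * b / c2" "c * a / c1"] sum
    by (simp add: add.commute)
  ultimately show ?thesis using sum by (simp add: scaleC_one)
qed

lemma U_scale:
  assumes m: "cinner m e = 0"
  obtains s where "cmod s = cmod c" "U (c *\<^sub>C m) = s *\<^sub>C U m"
proof -
  obtain k where k: "cmod k = cmod c" "f (c *\<^sub>C m) = k *\<^sub>C f m" using f_scale by blast
  obtain a where a: "cmod a = 1" "a \<noteq> 0" "U m = a *\<^sub>C f m" using U_in_ray[OF m] .
  obtain b where b: "cmod b = 1" "U (c *\<^sub>C m) = b *\<^sub>C f (c *\<^sub>C m)"
    using U_in_ray[of "c *\<^sub>C m"] m by (auto simp: cinner_linear)
  show thesis
    using that[of "b * k / a"] a b k by (simp add: norm_mult norm_divide)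
qed

text \<open>Expanding \<open>U (c *\<^sub>C (y + z))\<close> by additivity in two ways compares both factors with the
  factor for \<open>y + z\<close>.\<close>

lemma U_scale_same_factor:
  assumes y: "cinner y e = 0" and z: "cinner z e = 0"
    and yz: "y \<notin> complex_vector.span {z}" "z \<notin> complex_vector.span {y}"
    and s: "U (c *\<^sub>C y) = s *\<^sub>C U y" and t: "U (c *\<^sub>C z) = t *\<^sub>C U z"
  shows "s = t"
proof (cases "c = 0")
  case True
  have "y \<noteq> 0" "z \<noteq> 0" using yz complex_vector.span_zero by blast+
  then show ?thesis using True s t U_nonzero y z by simp
next
  case False
  obtain r where r: "U (c *\<^sub>C (y + z)) = r *\<^sub>C U (y + z)"
    using U_scale[of "y + z"] y z by (auto simp: cinner_linear)
  have "c *\<^sub>C y \<notin> complex_vector.span {c *\<^sub>C z}" "c *\<^sub>C z \<notin> complex_vector.span {c *\<^sub>C y}"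
    using yz False scale_notin_span_scale by blast+
  then have "U (c *\<^sub>C (y + z)) = s *\<^sub>C U y + t *\<^sub>C U z"
    using U_add_of_independent[of "c *\<^sub>C y" "c *\<^sub>C z"] y z
    by (simp add: scaleC_add_right s t cinner_linear)
  then have eq: "r *\<^sub>C U y + r *\<^sub>C U z = s *\<^sub>C U y + t *\<^sub>C U z"
    using r U_add_of_independent[OF y z yz] by (simp add: scaleC_add_right)
  obtain v where v: "B z v = 0" "B y v = 1" using exists_B_dual[of "{z}" y] yz by auto
  obtain w where w: "B y w = 0" "B z w = 1" using exists_B_dual[of "{y}" z] yz by auto
  have "B (U z) (f v) = 0" "B (U y) (f v) \<noteq> 0" "B (U y) (f w) = 0" "B (U z) (f w) \<noteq> 0"
    using U_orthogonal_iff y z v w by simp_all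
  then have "r = s" "r = t"
    using arg_cong[OF eq, of "\<lambda>x. B x (f v)"] arg_cong[OF eq, of "\<lambda>x. B x (f w)"] by simp_all
  then show ?thesis by simp
qed

end

section \<open>Extending to a semilinear operator\<close>

text \<open>The hypothesis on the dimension enters through two independent vectors \<open>p\<close>, \<open>q\<close> orthogonal
  to \<open>e\<close>: they allow scalar factors on different lines to be compared.\<close>

locale framed_ray_symmetry_dim3 = framed_ray_symmetry +
  fixes p q :: 'a
  assumes p: "cinner p e = 0" and q: "cinner q e = 0"
    and pq: "p \<noteq> 0" "q \<notin> complex_vector.span {p}"
begin

lemma qp: "q \<noteq> 0" "p \<notin> complex_vector.span {q}"
  using pq not_in_span_singleton_commute complex_vector.span_zero by blast+

definition \<sigma> :: "complex \<Rightarrow> complex" where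
  "\<sigma> c = (SOME s. cmod s = cmod c \<and> U (c *\<^sub>C p) = s *\<^sub>C U p)"

lemma \<sigma>_p: "cmod (\<sigma> c) = cmod c" "U (c *\<^sub>C p) = \<sigma> c *\<^sub>C U p"
proof -
  have "\<exists>s. cmod s = cmod c \<and> U (c *\<^sub>C p) = s *\<^sub>C U p"
    using U_scale[OF p] by metis
  then have "cmod (\<sigma> c) = cmod c \<and> U (c *\<^sub>C p) = \<sigma> c *\<^sub>C U p"
    unfolding \<sigma>_def by (rule someI_ex)
  then show "cmod (\<sigma> c) = cmod c" "U (c *\<^sub>C p) = \<sigma> c *\<^sub>C U p" by auto
qed

text \<open>The factor attached to \<open>c\<close> on the line of \<open>p\<close> is transported to any independent vector, and
  from \<open>q\<close> back to the multiples of \<open>p\<close>.\<close>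

lemma U_semihom:
  assumes m: "cinner m e = 0"
  shows "U (c *\<^sub>C m) = \<sigma> c *\<^sub>C U m"
proof -
  have step: "U (c *\<^sub>C z) = \<sigma> c *\<^sub>C U z"
    if yz: "cinner y e = 0" "cinner z e = 0" "y \<noteq> 0" "z \<notin> complex_vector.span {y}"
      "U (c *\<^sub>C y) = \<sigma> c *\<^sub>C U y" for y z
  proof -
    obtain t where t: "U (c *\<^sub>C z) = t *\<^sub>C U z" using U_scale[OF yz(2)] .
    have "\<sigma> c = t"
      using U_scale_same_factor[OF yz(1,2) _ yz(4,5) t]
        not_in_span_singleton_commute[OF yz(3,4)] .
    then show ?thesis using t by simp
  qed
  consider "m = 0" | "m \<notin> complex_vector.span {p}" | "m \<noteq> 0" "m \<in> complex_vector.span {p}" by blast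
  then show ?thesis
  proof cases
    case 1
    then show ?thesis by simp
  next
    case 2
    then show ?thesis using step[OF p m pq(1)] \<sigma>_p by blast
  next
    case 3
    \<comment> \<open>\<open>m\<close> is a multiple of \<open>p\<close>, so compare both with \<open>q\<close>\<close>
    then obtain k where k: "m = k *\<^sub>C p" by (auto simp: complex_vector.span_singleton)
    have "q \<notin> complex_vector.span {m}"
      using pq(2) by (auto simp: k complex_vector.span_singleton)
    then have "m \<notin> complex_vector.span {q}"
      using not_in_span_singleton_commute 3 by blast
    moreover have "U (c *\<^sub>C q) = \<sigma> c *\<^sub>C U q" using step[OF p q pq] \<sigma>_p by blast
    ultimately show ?thesis using step[OF q m qp(1)] by blast
  qed
qed

lemma \<sigma>_zero: "\<sigma> 0 = 0"
  using \<sigma>_p(1)[of 0] by simp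

lemma \<sigma>_mult: "\<sigma> (c * d) = \<sigma> c * \<sigma> d"
proof -
  have "\<sigma> (c * d) *\<^sub>C U p = (\<sigma> c * \<sigma> d) *\<^sub>C U p"
    using U_semihom[of "d *\<^sub>C p" c] p by (simp add: \<sigma>_p(2)[symmetric] cinner_linear scaleC_scaleC)
      (simp add: \<sigma>_p(2))
  then show ?thesis using U_nonzero[OF p pq(1)] by simp
qed

text \<open>As in the coordinatization of a projective plane, the sum \<open>c + d\<close> is read off from
  \<open>c *\<^sub>C p + (d *\<^sub>C p + q)\<close>: the auxiliary vector \<open>q\<close> keeps the two summands independent, so that
  additivity of \<open>U\<close> for independent vectors applies.\<close>

lemma \<sigma>_add: "\<sigma> (c + d) = \<sigma> c + \<sigma> d"
proof -
  have notin: "b *\<^sub>C p + q \<notin> complex_vector.span {a *\<^sub>C p}"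
    "a \<noteq> 0 \<Longrightarrow> a *\<^sub>C p \<notin> complex_vector.span {b *\<^sub>C p + q}" for a b
  proof -
    show 1: "b *\<^sub>C p + q \<notin> complex_vector.span {a *\<^sub>C p}"
    proof
      assume "b *\<^sub>C p + q \<in> complex_vector.span {a *\<^sub>C p}"
      then obtain k where "b *\<^sub>C p + q = k *\<^sub>C a *\<^sub>C p" by (auto simp: complex_vector.span_singleton)
      then have "q = (k * a - b) *\<^sub>C p"
        by (simp add: complex_vector.scale_left_diff_distrib eq_diff_eq add.commute)
      then show False using pq by (auto simp: complex_vector.span_singleton)
    qed
    show "a *\<^sub>C p \<notin> complex_vector.span {b *\<^sub>C p + q}" if "a \<noteq> 0"
      using not_in_span_singleton_commute[OF _ 1] that pq by simp
  qed
  have sum: "U (a *\<^sub>C p + (b *\<^sub>C p + q)) = \<sigma> a *\<^sub>C U p + U (b *\<^sub>C p + q)" for a b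
    using U_add_of_independent[of "a *\<^sub>C p" "b *\<^sub>C p + q"] p q notin
    by (cases "a = 0") (simp_all add: cinner_linear \<sigma>_p \<sigma>_zero)
  have "U ((c + d) *\<^sub>C p + (0 *\<^sub>C p + q)) = U (c *\<^sub>C p + (d *\<^sub>C p + q))"
    by (simp add: scaleC_add_left add.assoc)
  then have "\<sigma> (c + d) *\<^sub>C U p = (\<sigma> c + \<sigma> d) *\<^sub>C U p"
    using sum[of "c + d" 0] sum[of c d] sum[of d 0]
    by (simp add: scaleC_add_left add.assoc[symmetric])
  then show ?thesis using U_nonzero[OF p pq(1)] by simp
qed

lemma \<sigma>_cases: "\<sigma> = id \<or> \<sigma> = cnj"
  using modulus_preserving_automorphism \<sigma>_add \<sigma>_mult \<sigma>_p(1) by blast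

lemma \<sigma>_one: "\<sigma> 1 = 1"
  using \<sigma>_cases by auto

lemma U_add:
  assumes y: "cinner y e = 0" and z: "cinner z e = 0"
  shows "U (y + z) = U y + U z"
proof (cases "y = 0 \<or> z \<in> complex_vector.span {y}")
  case True
  then consider "y = 0" | k where "z = k *\<^sub>C y" by (auto simp: complex_vector.span_singleton)
  then show ?thesis
  proof cases
    case 2
    then have "U (y + z) = U ((1 + k) *\<^sub>C y)" by (simp add: scaleC_add_left scaleC_one)
    also have "\<dots> = (1 + \<sigma> k) *\<^sub>C U y" using U_semihom[OF y] by (simp add: \<sigma>_add \<sigma>_one)
    also have "\<dots> = U y + U z" using U_semihom[OF y, of k] 2 by (simp add: scaleC_add_left scaleC_one)
    finally show ?thesis .
  qed simp
next
  case False
  then show ?thesis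
    using U_add_of_independent[OF y z] not_in_span_singleton_commute by blast
qed

text \<open>An extension of \<open>U\<close> that is semilinear and induces the same map on rays must send \<open>e\<close> to
  \<open>f e\<close>, because \<open>f e\<close> is the phase reference for \<open>U\<close>.\<close>

definition W :: "'a \<Rightarrow> 'a" where
  "W x = \<sigma> (cinner x e) *\<^sub>C f e + U (x - cinner x e *\<^sub>C e)"

lemma proj_orth: "cinner (x - cinner x e *\<^sub>C e) e = 0"
  using e_unit by (simp add: cinner_linear)

lemma W_add: "W (x + y) = W x + W y"
proof -
  have eq: "x + y - cinner (x + y) e *\<^sub>C e = (x - cinner x e *\<^sub>C e) + (y - cinner y e *\<^sub>C e)"
    by (simp add: cinner_linear scaleC_add_left)
  then show ?thesis
    unfolding W_def eq U_add[OF proj_orth[of x] proj_orth[of y]]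
    by (simp add: \<sigma>_add cinner_add_left scaleC_add_left)
qed

lemma W_semihom: "W (c *\<^sub>C x) = \<sigma> c *\<^sub>C W x"
proof -
  have "c *\<^sub>C x - cinner (c *\<^sub>C x) e *\<^sub>C e = c *\<^sub>C (x - cinner x e *\<^sub>C e)"
    by (simp add: cinner_linear complex_vector.scale_right_diff_distrib)
  then show ?thesis
    using U_semihom[OF proj_orth[of x]]
    by (simp add: W_def \<sigma>_mult cinner_linear scaleC_add_right)
qed

text \<open>For \<open>x\<close> not orthogonal to \<open>e\<close> the claim scales to the case \<open>x = e + m\<close>, where it is the
  defining property of \<open>U m\<close>; \<open>\<sigma>\<close> preserving moduli makes the scaling harmless.\<close>

lemma W_in_ray: "\<exists>c. cmod c = 1 \<and> W x = c *\<^sub>C f x"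
proof (cases "cinner x e = 0")
  case True
  then show ?thesis using U_in_ray[OF True]
    by (metis W_def \<sigma>_zero add_0 complex_vector.scale_zero_left diff_zero)
next
  case False
  define a where "a = cinner x e"
  define m where "m = (1 / a) *\<^sub>C (x - a *\<^sub>C e)"
  have a: "a \<noteq> 0" using False by (simp add: a_def)
  have m: "cinner m e = 0" using proj_orth[of x] by (simp add: m_def a_def cinner_scaleC_left)
  have x: "x = a *\<^sub>C (e + m)" using a by (simp add: m_def scaleC_add_right scaleC_one)
  have Wem: "W (e + m) = f e + U m"
    using m e_unit by (simp add: W_def cinner_linear \<sigma>_one scaleC_one)
  obtain d where d: "cmod d = 1" "d \<noteq> 0" "f (e + m) = d *\<^sub>C (f e + U m)" using f_e_add[OF m] .
  obtain k where k: "cmod k = cmod a" "f (a *\<^sub>C (e + m)) = k *\<^sub>C f (e + m)" using f_scale by blast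
  have "k \<noteq> 0" using k a by auto
  then have "W x = (\<sigma> a / (k * d)) *\<^sub>C f x"
    using d k by (simp add: x W_semihom Wem)
  moreover have "cmod (\<sigma> a / (k * d)) = 1"
    using a d k by (simp add: norm_divide norm_mult \<sigma>_p(1))
  ultimately show ?thesis by blast
qed

end

text \<open>A wild automorphism of the complex field is excluded because moduli are preserved, which is
  why \<open>\<sigma>\<close> is the identity or conjugation. The frame is obtained by projecting two further vectors
  of a Hamel basis onto the orthogonal complement of a first one.\<close>

lemma (in ray_symmetry) semilinear_representatives:
  assumes "cdim_ge TYPE('a) 3"
  shows "\<exists>W \<sigma>. (\<sigma> = id \<or> \<sigma> = cnj) \<and> (\<forall>x y. W (x + y) = W x + W y) \<and>
    (\<forall>c x. W (c *\<^sub>C x) = \<sigma> c *\<^sub>C W x) \<and> (\<forall>x. \<exists>c. cmod c = 1 \<and> W x = c *\<^sub>C f x)"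
proof -
  obtain S :: "'a set" where S: "complex_vector.independent S" "infinite S \<or> 3 \<le> card S"
    using assms by (auto simp: cdim_ge_def)
  then obtain X where X: "X \<subseteq> S" "card X = 3" "finite X"
    by (metis infinite_arbitrarily_large obtain_subset_with_card_n)
  then obtain a b c where abc: "X = {a, b, c}" "distinct [a, b, c]"
    by (auto simp: card_Suc_eq numeral_3_eq_3)
  have indep: "complex_vector.independent {a, b, c}"
    using S X abc complex_vector.independent_mono by blast
  have a: "a \<notin> complex_vector.span {}" and b: "b \<notin> complex_vector.span {a}"
    and c: "c \<notin> complex_vector.span {b, a}"
    using indep abc complex_vector.independent_insert[of c "{b, a}"]
      complex_vector.independent_insert[of b "{a}"]
    by (auto simp: insert_commute)
  define e where "e = complex_of_real (1 / norm a) *\<^sub>C a"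
  define p where "p = b - cinner b e *\<^sub>C e"
  define q where "q = c - cinner c e *\<^sub>C e"
  have e: "cinner e e = 1"
    using a by (simp add: e_def norm_scaleC norm_divide cinner_self)
  have e_span: "k *\<^sub>C e \<in> complex_vector.span (insert a Y)" for k Y
    by (simp add: e_def complex_vector.span_scale complex_vector.span_base)
  have "p \<noteq> 0" using b e_span[of "cinner b e" "{}"] by (auto simp: p_def)
  have "q \<notin> complex_vector.span {p}"
  proof
    assume "q \<in> complex_vector.span {p}"
    then obtain k where k: "c - cinner c e *\<^sub>C e = k *\<^sub>C p"
      by (auto simp: complex_vector.span_singleton q_def)
    then have "c = k *\<^sub>C b + (cinner c e - k * cinner b e) *\<^sub>C e"
      by (simp add: p_def algebra_simps complex_vector.scale_right_diff_distrib
          complex_vector.scale_left_diff_distrib)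
    moreover have "b \<in> complex_vector.span {b, a}" "e \<in> complex_vector.span {b, a}"
      using e_span[of 1 "{b}"] by (simp_all add: complex_vector.span_base scaleC_one insert_commute)
    ultimately have "c \<in> complex_vector.span {b, a}"
      by (metis complex_vector.span_add complex_vector.span_scale)
    then show False using c by simp
  qed
  interpret framed_ray_symmetry_dim3 A f e p q
    by unfold_locales
      (use e \<open>p \<noteq> 0\<close> \<open>q \<notin> _\<close> in \<open>auto simp: p_def q_def cinner_linear\<close>)
  show ?thesis
    using \<sigma>_cases W_add W_semihom W_in_ray by blast
qed

section \<open>Boundedness and the adjoint identity\<close>

lemma ray_eq_iff: "ray x = ray y \<longleftrightarrow> (\<exists>c. cmod c = 1 \<and> x = c *\<^sub>C y)"
proof
  assume "ray x = ray y"
  then show "\<exists>c. cmod c = 1 \<and> x = c *\<^sub>C y" using self_mem_ray[of x] by (auto simp: ray_def)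
next
  have sub: "ray (c *\<^sub>C z) \<subseteq> ray z" if "cmod c = 1" for c and z :: 'a
    using that by (force simp: ray_def scaleC_scaleC norm_mult)
  assume "\<exists>c. cmod c = 1 \<and> x = c *\<^sub>C y"
  then obtain c where c: "cmod c = 1" "x = c *\<^sub>C y" by blast
  then have "c \<noteq> 0" by auto
  then have "y = inverse c *\<^sub>C x" "cmod (inverse c) = 1"
    using c by (simp_all add: scaleC_scaleC scaleC_one norm_inverse)
  then show "ray x = ray y" using sub[of c y] sub[of "inverse c" x] c by auto
qed

theorem corollary1:
  fixes A :: "'a::complex_hilbert_space \<Rightarrow> 'a"
    and T :: "'a set \<Rightarrow> 'a set"
  assumes "cdim_ge TYPE('a) 3"
    and "invertible_bounded_clinear A"
    and "bij_betw T rays rays"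
    and "\<And>x y. ray_prod A (T (ray x)) (T (ray y)) = ray_prod A (ray x) (ray y)"
  shows "\<exists>U \<epsilon>. cmod \<epsilon> = 1 \<and>
    (invertible_bounded_clinear U \<and>
       clinear_adjoint U \<circ> A \<circ> U = (\<lambda>x. \<epsilon> *\<^sub>C A x) \<or>
     invertible_bounded_antilinear U \<and>
       antilinear_adjoint U \<circ> A \<circ> U = (\<lambda>x. \<epsilon> *\<^sub>C A x)) \<and>
    (\<forall>x. T (ray x) = ray (U x))"
proof -
  obtain A' where A: "bounded_clinear A" and A': "bounded_clinear A'"
    and "A' \<circ> A = id" "A \<circ> A' = id"
    using assms(2) by (auto simp: invertible_bounded_clinear_def)
  then have A'A [simp]: "A' (A x) = x" and AA' [simp]: "A (A' x) = x" for x
    by (simp_all add: fun_eq_iff)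
  interpret A: bounded_clinear A by fact
  interpret A': bounded_clinear A' by fact
  \<comment> \<open>representatives with arbitrary phases; \<open>semilinear_representatives\<close> corrects them\<close>
  define f where "f x = (SOME z. T (ray x) = ray z)" for x
  have f: "T (ray x) = ray (f x)" for x
  proof -
    have "T (ray x) \<in> rays" using bij_betwE[OF assms(3)] by (auto simp: rays_def)
    then show ?thesis unfolding f_def rays_def by (metis (mono_tags, lifting) imageE someI_ex)
  qed
  have f_onto: "\<exists>x c. cmod c = 1 \<and> z = c *\<^sub>C f x" for z
  proof -
    have "ray z \<in> T ` rays" using assms(3) by (simp add: bij_betw_def rays_def)
    then show ?thesis by (auto simp: rays_def f ray_eq_iff)
  qed
  interpret ray_symmetry A f
  proof unfold_locales
    show "inj A" by (metis A'A injI)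
    show "cmod (cinner (A (f x)) (f y)) = cmod (cinner (A x) y)" for x y
      using assms(4)[of x y] by (simp add: f ray_prod_ray[OF A])
  qed (simp_all add: A.add A.scaleC f_onto)
  obtain U \<sigma> where \<sigma>: "\<sigma> = id \<or> \<sigma> = cnj" and U_add: "\<And>x y. U (x + y) = U x + U y"
    and U_scale: "\<And>c x. U (c *\<^sub>C x) = \<sigma> c *\<^sub>C U x"
    and U_ray: "\<And>x. \<exists>c. cmod c = 1 \<and> U x = c *\<^sub>C f x"
    using semilinear_representatives[OF assms(1)] by blast
  \<comment> \<open>properties common to the identity and conjugation, so that both cases can be treated together\<close>
  have \<sigma>_simps [simp]: "\<sigma> (\<sigma> c) = c" "cmod (\<sigma> c) = cmod c" "\<sigma> (complex_of_real r) = complex_of_real r"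
    "\<sigma> (c + d) = \<sigma> c + \<sigma> d" "\<sigma> (c * d) = \<sigma> c * \<sigma> d" "\<sigma> (cnj c) = cnj (\<sigma> c)" for c d r
    using \<sigma> by auto
  have TU: "T (ray x) = ray (U x)" for x
    using f[of x] U_ray[of x] ray_eq_iff by metis
  have "inj U"
  proof (rule injI)
    fix x y assume "U x = U y"
    have "U (x - y) = 0" using U_add[of "x - y" y] \<open>U x = U y\<close> by simp
    moreover have "U 0 = 0" using U_scale[of 0 0] \<sigma> by auto
    ultimately have "ray (x - y) = ray 0"
      using assms(3) TU by (metis bij_betw_imp_inj_on inj_onD rangeI rays_def)
    then show "x = y" by (auto simp: ray_eq_iff)
  qed
  moreover have "surj U"
  proof (unfold surj_def, rule allI)
    fix z
    obtain x c where c: "z = c *\<^sub>C f x" using f_onto by blast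
    obtain d where d: "cmod d = 1" "U x = d *\<^sub>C f x" using U_ray by blast
    have "d \<noteq> 0" using d(1) by auto
    then have "z = U (\<sigma> (c / d) *\<^sub>C x)" using c d by (simp add: U_scale)
    then show "\<exists>x. z = U x" by blast
  qed
  ultimately have "bij U" by (simp add: bij_def)
  define V where "V = inv U"
  have UV [simp]: "U (V x) = x" and VU [simp]: "V (U x) = x" for x
    using \<open>bij U\<close> by (simp_all add: V_def bij_is_inj bij_is_surj surj_f_inv_f)
  have V_add: "V (x + y) = V x + V y" for x y
    by (metis UV VU U_add)
  have V_scale: "V (c *\<^sub>C x) = \<sigma> c *\<^sub>C V x" for c x
    by (metis UV VU U_scale \<sigma>_simps(1))
  have mod: "cmod (cinner (A (U x)) (U y)) = cmod (cinner (A x) y)" for x y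
    using assms(4)[of x y] by (simp add: TU ray_prod_ray[OF A])
  obtain \<epsilon> where \<epsilon>: "cmod \<epsilon> = 1" "\<And>x y. \<sigma> (cinner (A (U x)) (U y)) = \<epsilon> * cinner (A x) y"
    using forms_equal_modulus[of "\<lambda>x y. cinner (A x) y" "\<lambda>x y. \<sigma> (cinner (A (U x)) (U y))"]
    by (auto simp: A.add A.scaleC U_add U_scale cinner_linear mod)
  \<comment> \<open>\<open>G\<close> is \<open>A U A\<^sup>-\<^sup>1\<close>, the formal adjoint of \<open>U\<^sup>-\<^sup>1\<close> up to phase and conjugation\<close>
  define G where "G x = A (U (A' x))" for x
  have lin: "linear F" if "\<And>x y. F (x + y) = F x + F y" "\<And>c x. F (c *\<^sub>C x) = \<sigma> c *\<^sub>C F x"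
    for F :: "'a \<Rightarrow> 'a"
    by (rule linearI) (simp_all add: that scaleR_scaleC)
  have adj: "cmod (cinner (G x) z) = cmod (cinner x (V z))" for x z
    using mod[of "A' x" "V z"] by (simp add: G_def)
  have V_bounded: "bounded_linear V"
    using bounded_if_adjoint[OF adj] lin V_add V_scale by blast
  have "cmod (cinner (V z) x) = cmod (cinner z (G x))" for x z
    using adj[of x z] cinner_commute by (metis complex_mod_cnj)
  moreover have "linear G"
    by (rule lin) (simp_all add: G_def A.add A.scaleC A'.add A'.scaleC U_add U_scale)
  ultimately have "bounded_linear G" using bounded_if_adjoint[of V G] by blast
  then have "bounded_linear (\<lambda>x. A' (G (A x)))"
    by (rule bounded_linear_compose[OF A'.bounded_linear_axioms
          bounded_linear_compose[OF _ A.bounded_linear_axioms]])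
  then have U_bounded: "bounded_linear U" by (simp add: G_def)
  \<comment> \<open>the only candidate for the adjoint that satisfies \<open>U\<^sup>* A U = \<epsilon> A\<close>\<close>
  define Us where "Us y = \<epsilon> *\<^sub>C A (V (A' y))" for y
  have Us_adj: "cinner (U x) y = \<sigma> (cinner x (Us y))" for x y
  proof -
    have "\<sigma> (cinner y (U x)) = \<epsilon> * cinner (A (V (A' y))) x"
      using \<epsilon>(2)[of "V (A' y)" x] by simp
    then have "cinner y (U x) = \<sigma> (\<epsilon> * cinner (A (V (A' y))) x)" by (metis \<sigma>_simps(1))
    also have "\<dots> = \<sigma> (cinner (Us y) x)" by (simp add: Us_def cinner_linear)
    finally show ?thesis by (metis cinner_commute \<sigma>_simps(6))
  qed
  have \<epsilon>_bounded: "bounded_linear (\<lambda>x::'a. \<epsilon> *\<^sub>C x)"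
    using \<epsilon>(1) by (intro bounded_linear_intro[where K = 1])
      (simp_all add: scaleC_add_right scaleR_scaleC norm_scaleC mult.commute)
  have Us_bounded: "bounded_linear Us"
    unfolding Us_def
    by (rule bounded_linear_compose[OF \<epsilon>_bounded
          bounded_linear_compose[OF A.bounded_linear_axioms
            bounded_linear_compose[OF V_bounded A'.bounded_linear_axioms]]])
  have Us_scale: "Us (c *\<^sub>C y) = \<sigma> c *\<^sub>C Us y" for c y
    by (simp add: Us_def A.scaleC A'.scaleC V_scale mult.commute)
  have Us_A_U: "Us \<circ> A \<circ> U = (\<lambda>x. \<epsilon> *\<^sub>C A x)" by (simp add: Us_def fun_eq_iff)
  have VU_id: "V \<circ> U = id" "U \<circ> V = id" by (simp_all add: fun_eq_iff)
  show ?thesis using \<sigma>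
  proof
    assume id: "\<sigma> = id"
    have "bounded_clinear U" "bounded_clinear V" "bounded_clinear Us"
      using U_bounded V_bounded Us_bounded U_scale V_scale Us_scale id
      by (auto simp: bounded_clinear_def bounded_clinear_axioms_def)
    moreover from this(3) have "clinear_adjoint U = Us"
      by (rule clinear_adjoint_eqI) (simp add: Us_adj id)
    ultimately show ?thesis
      using \<epsilon>(1) Us_A_U VU_id TU unfolding invertible_bounded_clinear_def by metis
  next
    assume cnj: "\<sigma> = cnj"
    have "bounded_antilinear U" "bounded_antilinear V" "bounded_antilinear Us"
      using U_bounded V_bounded Us_bounded U_scale V_scale Us_scale cnj
      by (auto simp: bounded_antilinear_def bounded_antilinear_axioms_def)
    moreover from this(3) have "antilinear_adjoint U = Us"
      by (rule antilinear_adjoint_eqI) (simp add: Us_adj cnj)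
    ultimately show ?thesis
      using \<epsilon>(1) Us_A_U VU_id TU unfolding invertible_bounded_antilinear_def by metis
  qed
qed

end
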